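(* Let $n\ge2$. There exists a constant $C>0$ such that for every $R>0$ $$B(e,R)\subseteq\{z\in\mathbb S:\ \varpi(z,e)\le C R,\ \ |\Im\langle z,e\rangle|\le C R^2\}.$$
   Context: $\mathbb S=\{z\in\mathbb C^n:|z|=1\}$, $e=(1,0,\dots,0)\in\mathbb S$, $\langle z,w\rangle=\sum_{j=1}^n z_j\bar w_j$, $\varpi(z,w)=(1-|\langle z,w\rangle|^2)^{1/2}$, $\varrho(z,w)=|1-\langle z,w\rangle|^{1/2}$, and $B(z,R)=\{w\in\mathbb S:\varrho(z,w)<R\}$. *)

theory Defs
  imports "HOL-Analysis.Analysis"
begin

text \<open>
  Complex n-space is \<^typ>\<open>complex ^ 'n\<close> with n = \<^term>\<open>CARD('n)\<close>; its library norm is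
  the Euclidean norm, so the unit sphere is \<^term>\<open>sphere 0 1\<close>. The library's inner product
  on \<^typ>\<open>complex ^ 'n\<close> is real-valued, hence the separate Hermitian product.
\<close>

definition hermitian :: "complex ^ 'n \<Rightarrow> complex ^ 'n \<Rightarrow> complex"
  where "hermitian z w = (\<Sum>j\<in>UNIV. z $ j * cnj (w $ j))"

text \<open>The linear order on the index type serves only to single out a first coordinate.\<close>

definition e_vec :: "complex ^ 'n::{finite,linorder}"
  where "e_vec = axis (Min UNIV) 1"

definition varpi :: "complex ^ 'n \<Rightarrow> complex ^ 'n \<Rightarrow> real"
  where "varpi z w = sqrt (1 - (cmod (hermitian z w))\<^sup>2)"

definition varrho :: "complex ^ 'n \<Rightarrow> complex ^ 'n \<Rightarrow> real"
  where "varrho z w = sqrt (cmod (1 - hermitian z w))"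

definition varrho_ball :: "complex ^ 'n \<Rightarrow> real \<Rightarrow> (complex ^ 'n) set"
  where "varrho_ball z R = {w \<in> sphere 0 1. varrho z w < R}"

end

theory Submission
  imports Defs
begin

text \<open>
  Write \<open>a = \<langle>z, w\<rangle>\<close>. Membership in a \<open>\<varrho>\<close>-ball of radius \<open>R\<close> around \<open>w\<close> says that
  \<open>a\<close> lies within \<open>R\<^sup>2\<close> of the point 1 of the complex plane, and both conclusions are bounds
  on \<open>a\<close> alone. The imaginary part of \<open>a\<close> is that of \<open>a - 1\<close>, so it is at most \<open>R\<^sup>2\<close>.
  The defect \<open>1 - |a|\<^sup>2\<close> is at most \<open>2 (1 - |a|)\<close>, hence at most \<open>2 R\<^sup>2\<close> by
  the triangle inequality, and its square root is at most \<open>\<surd>2 R\<close>.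
  Thus \<open>C = 2\<close> serves for every centre.
\<close>

lemma hermitian_commute: "hermitian w z = cnj (hermitian z w)"
  by (simp add: hermitian_def mult.commute)

lemma cmod_one_minus_hermitian_commute:
  "cmod (1 - hermitian w z) = cmod (1 - hermitian z w)"
proof -
  have "1 - hermitian w z = cnj (1 - hermitian z w)"
    by (simp add: hermitian_commute [of w z])
  then show ?thesis
    by (metis complex_mod_cnj)
qed

lemma varrho_less_iff:
  assumes "R > 0"
  shows "varrho w z < R \<longleftrightarrow> cmod (1 - hermitian z w) < R\<^sup>2"
proof -
  have "varrho w z < R \<longleftrightarrow> sqrt (cmod (1 - hermitian z w)) < sqrt (R\<^sup>2)"
    using assms by (simp add: varrho_def cmod_one_minus_hermitian_commute)
  then show ?thesis
    by (simp only: real_sqrt_less_iff)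
qed

text \<open>
  The graph of \<open>1 - t\<^sup>2\<close> lies below its tangent line \<open>2 (1 - t)\<close> at \<open>t = 1\<close>;
  taking \<open>t = |a|\<close> leaves only the reverse triangle inequality.
\<close>

lemma one_minus_cmod_square_le:
  fixes a :: complex
  shows "1 - (cmod a)\<^sup>2 \<le> 2 * cmod (1 - a)"
proof -
  have "1 - (cmod a)\<^sup>2 = 2 * (1 - cmod a) - (1 - cmod a)\<^sup>2"
    by (simp add: power2_eq_square algebra_simps)
  also have "\<dots> \<le> 2 * (1 - cmod a)"
    by simp
  also have "\<dots> \<le> 2 * cmod (1 - a)"
    using norm_triangle_ineq2 [of 1 a] by simp
  finally show ?thesis .
qed

lemma varrho_ball_subset:
  assumes "R > 0"
  shows "varrho_ball w R
    \<subseteq> {z \<in> sphere 0 1. varpi z w \<le> 2 * R \<and> \<bar>Im (hermitian z w)\<bar> \<le> 2 * R\<^sup>2}"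
proof
  fix z
  assume z: "z \<in> varrho_ball w R"
  then have "cmod (1 - hermitian z w) < R\<^sup>2"
    using assms by (simp add: varrho_ball_def varrho_less_iff)
  then have near: "cmod (1 - hermitian z w) \<le> 2 * R\<^sup>2"
    using zero_le_power2 [of R] by linarith
  have "1 - (cmod (hermitian z w))\<^sup>2 \<le> 2 * cmod (1 - hermitian z w)"
    by (rule one_minus_cmod_square_le)
  also have "\<dots> \<le> (2 * R)\<^sup>2"
    using near by (simp add: power_mult_distrib)
  finally have "varpi z w \<le> 2 * R"
    unfolding varpi_def using assms by (intro real_le_lsqrt) auto
  moreover have "\<bar>Im (hermitian z w)\<bar> \<le> 2 * R\<^sup>2"
    using abs_Im_le_cmod [of "1 - hermitian z w"] near by simp
  ultimately show "z \<in> {z \<in> sphere 0 1. varpi z w \<le> 2 * R \<and> \<bar>Im (hermitian z w)\<bar> \<le> 2 * R\<^sup>2}"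
    using z by (simp add: varrho_ball_def)
qed

theorem lemma2p3:
  assumes "CARD('n::{finite,linorder}) \<ge> 2"
  shows "\<exists>C::real. C > 0 \<and> (\<forall>R::real. R > 0 \<longrightarrow>
    varrho_ball (e_vec :: complex ^ 'n::{finite,linorder}) R
      \<subseteq> {z \<in> sphere 0 1. varpi z e_vec \<le> C * R \<and> \<bar>Im (hermitian z e_vec)\<bar> \<le> C * R\<^sup>2})"
  by (intro exI [of _ 2] conjI allI impI varrho_ball_subset) simp_all

end
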